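(* For every bipartite graph $G$ of maximum degree $d$ with vertex bipartition $(U,V)$ such that $|U|>|V|$, there is a Circular Resolution refutation of $G\text{-}\mathrm{PHP}$ of length polynomial in $|U|+|V|$ and width $d$.
   Context: Graph pigeonhole principle. For a (finite) bipartite graph $G$ with bipartition $(U,V)$ and edge set $E\subseteq U\times V$, let $N_G(w)$ be the set of neighbours of $w$. The CNF formula $G\text{-}\mathrm{PHP}$ has one variable $X_{u,v}$ for each edge $(u,v)\in E$ and the clauses: $X_{u,v_1}\vee\cdots\vee X_{u,v_r}$ for each $u\in U$ with $N_G(u)=\{v_1,\dots,v_r\}$; and $\overline{X_{u_1,v}}\vee\overline{X_{u_2,v}}$ for all $u_1\neq u_2$ in $U$ and $v\in N_G(u_1)\cap N_G(u_2)$. Circular Resolution. A literal is a propositional variable $X$ or its negation $\overline{X}$. A clause is a finite set of literals read as a disjunction; $0$ denotes the empty clause. The rules are, for clauses $C$ and variables $X$: axiom (no premises, conclusion $X\vee\overline{X}$); symmetric cut (premises $C\vee X$ and $C\vee\overline{X}$, conclusion $C$); split (premise $C$, two conclusions $C\vee X$ and $C\vee\overline{X}$). A circular pre-proof $\Pi$ is a finite directed bipartite graph with formula-vertices (set $J$), each labelled by a clause, and inference-vertices (set $I$), each labelled by an instance of a rule whose premises are the labels of its in-neighbours and whose conclusions are the labels of its out-neighbours; cycles are allowed. A flow assignment is a map $F:I\to\mathbb{R}^+$ to the positive reals; the balance of $u\in J$ is $B(u)=\sum_{w\in N^-(u)}F(w)-\sum_{w\in N^+(u)}F(w)$, where $N^-(u),N^+(u)$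 are the sets of in- and out-neighbours of $u$. Sources are the formula-vertices of strictly negative balance, sinks those of strictly positive balance. $\Pi$ is a Circular Resolution proof of a clause $A$ from a set of clauses $\mathscr{H}$ if there is a flow assignment for which every source is labelled by a clause in $\mathscr{H}$ and some sink is labelled by $A$. A refutation of $\mathscr{H}$ is a proof of the empty clause $0$ from $\mathscr{H}$; a refutation of a CNF formula is a refutation of its set of clauses. The length of the proof is its number of vertices and its width is the maximum number of literals in a clause labelling a formula-vertex.
   Formalization: The width is stated as max(d,1) instead of d: for graphs without edges (d = 0) width 0 is impossible, since deriving the empty clause as a sink needs a cut on unit clauses; for every d ≥ 1 the width is exactly d. *)

theory Defs
  imports Complex_Main "HOL-Library.Multiset" "HOL-Computational_Algebra.Polynomial"
begin

definition bipartite_graph :: "'a set \<Rightarrow> 'a set \<Rightarrow> ('a \<times> 'a) set \<Rightarrow> bool" where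
  "bipartite_graph U V E \<longleftrightarrow> finite U \<and> finite V \<and> U \<inter> V = {} \<and> E \<subseteq> U \<times> V"

text \<open>Edges are stored as pairs oriented from \<open>U\<close> to \<open>V\<close>, but the graph is undirected,
  hence the symmetrised neighbourhood.\<close>

definition neighbours :: "('a \<times> 'a) set \<Rightarrow> 'a \<Rightarrow> 'a set" where
  "neighbours E w = {x. (w, x) \<in> E \<or> (x, w) \<in> E}"

definition max_degree :: "'a set \<Rightarrow> 'a set \<Rightarrow> ('a \<times> 'a) set \<Rightarrow> nat" where
  "max_degree U V E = Max ((\<lambda>w. card (neighbours E w)) ` (U \<union> V))"

datatype 'x literal = Pos 'x | Neg 'x

type_synonym 'x clause = "'x literal set"

definition graph_php :: "'a set \<Rightarrow> ('a \<times> 'a) set \<Rightarrow> ('a \<times> 'a) clause set" where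
  "graph_php U E =
     {{Pos (u, v) | v. v \<in> neighbours E u} | u. u \<in> U} \<union>
     {{Neg (u1, v), Neg (u2, v)} | u1 u2 v.
        u1 \<in> U \<and> u2 \<in> U \<and> u1 \<noteq> u2 \<and> v \<in> neighbours E u1 \<inter> neighbours E u2}"

datatype 'x inference = Axiom 'x | Cut "'x clause" 'x | Split "'x clause" 'x

fun premise_clauses :: "'x inference \<Rightarrow> 'x clause multiset" where
  "premise_clauses (Axiom X) = {#}"
| "premise_clauses (Cut C X) = {# insert (Pos X) C, insert (Neg X) C #}"
| "premise_clauses (Split C X) = {# C #}"

fun conclusion_clauses :: "'x inference \<Rightarrow> 'x clause multiset" where
  "conclusion_clauses (Axiom X) = {# {Pos X, Neg X} #}"
| "conclusion_clauses (Cut C X) = {# C #}"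
| "conclusion_clauses (Split C X) = {# insert (Pos X) C, insert (Neg X) C #}"

text \<open>The arcs of the directed bipartite graph are split into those entering inference-vertices
  (\<open>prem_arcs\<close>) and those leaving them (\<open>concl_arcs\<close>).\<close>

record ('j, 'i, 'x) circular =
  formula_verts :: "'j set"
  inference_verts :: "'i set"
  prem_arcs :: "('j \<times> 'i) set"
  concl_arcs :: "('i \<times> 'j) set"
  clause_at :: "'j \<Rightarrow> 'x clause"
  inference_at :: "'i \<Rightarrow> 'x inference"

text \<open>Labels of neighbours are compared with the rule as multisets: every premise and every
  conclusion of the rule instance corresponds to exactly one neighbour. Comparing mere sets of
  labels would be unsound, as it would allow an inference to feed its flow to several copies of
  the same conclusion.\<close>

definition circular_preproof :: "('j, 'i, 'x) circular \<Rightarrow> bool" where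
  "circular_preproof P \<longleftrightarrow>
     finite (formula_verts P) \<and> finite (inference_verts P) \<and>
     prem_arcs P \<subseteq> formula_verts P \<times> inference_verts P \<and>
     concl_arcs P \<subseteq> inference_verts P \<times> formula_verts P \<and>
     (\<forall>j\<in>formula_verts P. finite (clause_at P j)) \<and>
     (\<forall>i\<in>inference_verts P.
        image_mset (clause_at P) (mset_set {j. (j, i) \<in> prem_arcs P})
          = premise_clauses (inference_at P i) \<and>
        image_mset (clause_at P) (mset_set {j. (i, j) \<in> concl_arcs P})
          = conclusion_clauses (inference_at P i))"

definition flow_assignment :: "('j, 'i, 'x) circular \<Rightarrow> ('i \<Rightarrow> real) \<Rightarrow> bool" where
  "flow_assignment P F \<longleftrightarrow> (\<forall>i\<in>inference_verts P. F i > 0)"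

definition balance :: "('j, 'i, 'x) circular \<Rightarrow> ('i \<Rightarrow> real) \<Rightarrow> 'j \<Rightarrow> real" where
  "balance P F j =
     (\<Sum>i\<in>{i. (i, j) \<in> concl_arcs P}. F i) - (\<Sum>i\<in>{i. (j, i) \<in> prem_arcs P}. F i)"

definition circular_proof ::
    "('j, 'i, 'x) circular \<Rightarrow> 'x clause set \<Rightarrow> 'x clause \<Rightarrow> bool" where
  "circular_proof P H A \<longleftrightarrow> circular_preproof P \<and>
     (\<exists>F. flow_assignment P F \<and>
        (\<forall>j\<in>formula_verts P. balance P F j < 0 \<longrightarrow> clause_at P j \<in> H) \<and>
        (\<exists>j\<in>formula_verts P. balance P F j > 0 \<and> clause_at P j = A))"

definition circular_refutation :: "('j, 'i, 'x) circular \<Rightarrow> 'x clause set \<Rightarrow> bool" where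
  "circular_refutation P H \<longleftrightarrow> circular_proof P H {}"

definition proof_length :: "('j, 'i, 'x) circular \<Rightarrow> nat" where
  "proof_length P = card (formula_verts P) + card (inference_verts P)"

text \<open>Every refutation has width at least 1: a sink labelled by the empty clause is the conclusion of
  some inference, necessarily a cut, whose premises are unit clauses. For an edgeless graph the least
  possible width is therefore 1 and not the maximum degree 0.\<close>

definition proof_width :: "('j, 'i, 'x) circular \<Rightarrow> nat" where
  "proof_width P = Max ((\<lambda>j. card (clause_at P j)) ` formula_verts P)"

end

theory Submission
  imports Defs
begin

text \<open>Each pigeon \<open>u\<close> turns its hypothesis together with the unit clauses \<open>\<not>X\<^sub>u\<^sub>v\<close>, one for each \<open>v \<in> N(u)\<close>,
  into one copy of the empty clause. Each hole \<open>v\<close> turns one copy of the empty clause into the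
  unit clauses \<open>\<not>X\<^sub>u\<^sub>v\<close>, one for each \<open>u \<in> N(v)\<close>. Every edge occurs once on either side, so \<open>|V|\<close>
  copies of the empty clause yield \<open>|U|\<close> copies. Circularity allows the \<open>|V|\<close> copies to be fed
  back, and at least one remains. All flows are 1.\<close>

section \<open>Derivability measured by totals of premises and conclusions\<close>

text \<open>Premises and conclusions must be pairwise distinct (hence the bounds on the counts), because the
  refutation will have a single formula-vertex for each clause.\<close>

definition proper_inference :: "nat \<Rightarrow> 'x inference \<Rightarrow> bool" where
  "proper_inference w i \<longleftrightarrow>
     (\<forall>c. count (premise_clauses i) c \<le> 1 \<and> count (conclusion_clauses i) c \<le> 1) \<and>
     (\<forall>c \<in># premise_clauses i + conclusion_clauses i. finite c \<and> card c \<le> w)"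

text \<open>Using at most \<open>n\<close> inferences of width at most \<open>w\<close> and arbitrarily many hypotheses from \<open>H\<close>, the
  clauses in \<open>A\<close> are consumed and those in \<open>B\<close> produced, up to a surplus. The inferences are not
  ordered: only the totals of premises and conclusions are compared.\<close>

definition circ_derives ::
    "'x clause set \<Rightarrow> nat \<Rightarrow> nat \<Rightarrow> 'x clause multiset \<Rightarrow> 'x clause multiset \<Rightarrow> bool" where
  "circ_derives H w n A B \<longleftrightarrow> (\<exists>L K. length L \<le> n \<and> (\<forall>i\<in>set L. proper_inference w i) \<and>
     set_mset K \<subseteq> H \<and>
     sum_list (map premise_clauses L) + B \<subseteq># sum_list (map conclusion_clauses L) + A + K)"

lemma circ_derivesI:
  assumes "length L \<le> n" "\<And>i. i \<in> set L \<Longrightarrow> proper_inference w i" "set_mset K \<subseteq> H"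
    "sum_list (map premise_clauses L) + B \<subseteq># sum_list (map conclusion_clauses L) + A + K"
  shows "circ_derives H w n A B"
  using assms unfolding circ_derives_def by blast

lemma circ_derives_subset: "B \<subseteq># A \<Longrightarrow> circ_derives H w n A B"
  by (rule circ_derivesI[of "[]" _ _ "{#}"]) auto

lemma circ_derives_hyp: "set_mset A \<subseteq> H \<Longrightarrow> circ_derives H w n {#} A"
  by (rule circ_derivesI[of "[]" _ _ A]) auto

lemma circ_derives_inference:
  assumes "proper_inference w i" "n \<ge> 1"
  shows "circ_derives H w n (premise_clauses i) (conclusion_clauses i)"
  by (rule circ_derivesI[of "[i]" _ _ "{#}"]) (use assms in auto)

lemma circ_derives_add:
  assumes "circ_derives H w m A B" "circ_derives H w n C D" "m + n \<le> k"
  shows "circ_derives H w k (A + C) (B + D)"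
proof -
  obtain L1 K1 where 1: "length L1 \<le> m" "\<forall>i\<in>set L1. proper_inference w i" "set_mset K1 \<subseteq> H"
    "sum_list (map premise_clauses L1) + B \<subseteq># sum_list (map conclusion_clauses L1) + A + K1"
    using assms(1) unfolding circ_derives_def by blast
  obtain L2 K2 where 2: "length L2 \<le> n" "\<forall>i\<in>set L2. proper_inference w i" "set_mset K2 \<subseteq> H"
    "sum_list (map premise_clauses L2) + D \<subseteq># sum_list (map conclusion_clauses L2) + C + K2"
    using assms(2) unfolding circ_derives_def by blast
  show ?thesis
    by (rule circ_derivesI[of "L1 @ L2" _ _ "K1 + K2"])
      (use 1 2 assms(3) subset_mset.add_mono[OF 1(4) 2(4)] in \<open>auto simp: ac_simps\<close>)
qed

text \<open>Only totals are compared, so copies of \<open>C\<close> produced by the inferences may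
  serve as the copies they consume. This is where circularity enters.\<close>

lemma circ_derives_cancel:
  assumes "circ_derives H w n (A + C) (B + C)"
  shows "circ_derives H w n A B"
proof -
  obtain L K where 1: "length L \<le> n" "\<forall>i\<in>set L. proper_inference w i" "set_mset K \<subseteq> H"
    "sum_list (map premise_clauses L) + (B + C) \<subseteq># sum_list (map conclusion_clauses L) + (A + C) + K"
    using assms unfolding circ_derives_def by blast
  have "C + (sum_list (map premise_clauses L) + B) \<subseteq># C + (sum_list (map conclusion_clauses L) + A + K)"
    using 1(4) by (simp add: ac_simps)
  then have "sum_list (map premise_clauses L) + B \<subseteq># sum_list (map conclusion_clauses L) + A + K"
    by (simp only: subset_mset.add_le_cancel_left)
  with 1 show ?thesis
    by (intro circ_derivesI[of L _ _ K]) auto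
qed

text \<open>Adding the two derivations consumes \<open>A + B\<close> and produces
  \<open>B + C\<close>; the intermediate \<open>B\<close> is then cancelled.\<close>

lemma circ_derives_trans:
  assumes "circ_derives H w m A B" "circ_derives H w n B C" "m + n \<le> k"
  shows "circ_derives H w k A C"
  using circ_derives_add[OF assms] circ_derives_cancel[of H w k A B C] by (simp add: ac_simps)

lemma circ_derives_frame:
  assumes "circ_derives H w n A B"
  shows "circ_derives H w n (A + C) (B + C)"
  using circ_derives_add[OF assms circ_derives_subset[of C C H w 0]] by simp

lemma circ_derives_sum:
  assumes "finite S" "\<And>s. s \<in> S \<Longrightarrow> circ_derives H w n (A s) (B s)"
  shows "circ_derives H w (card S * n) (\<Sum>s\<in>S. A s) (\<Sum>s\<in>S. B s)"
  using assms
proof (induction S)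
  case empty
  show ?case by (simp add: circ_derives_subset)
next
  case (insert s S)
  then show ?case
    using circ_derives_add[of H w n "A s" "B s" "card S * n"] by simp
qed

section \<open>Derivations by splits and cuts\<close>

text \<open>If \<open>C\<close> contained both literals of \<open>X\<close>, the two extended
  clauses would coincide with \<open>C\<close>, which a proper inference forbids.\<close>

lemma proper_split_cut:
  assumes "finite C" "card C < w" "\<not> (Pos X \<in> C \<and> Neg X \<in> C)"
  shows "proper_inference w (Split C X)" "proper_inference w (Cut C X)"
proof -
  have "insert (Pos X) C \<noteq> insert (Neg X) C"
    using assms(3) by auto
  moreover have "card (insert l C) \<le> w" for l
    using card_insert_le_m1[of w C l] assms(2) by simp
  ultimately show "proper_inference w (Split C X)" "proper_inference w (Cut C X)"
    using assms(1,2) unfolding proper_inference_def by auto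
qed

text \<open>Split on each \<open>y\<close> in turn and keep the half with \<open>Pos y\<close>; the
  other half stays behind as surplus.\<close>

lemma circ_derives_weaken:
  assumes "finite C" "card C + length ys \<le> w" "\<And>y. y \<in> set ys \<Longrightarrow> Neg y \<notin> C"
  shows "circ_derives H w (length ys) {#C#} {#C \<union> Pos ` set ys#}"
  using assms
proof (induction ys arbitrary: C)
  case Nil
  show ?case by (simp add: circ_derives_subset)
next
  case (Cons y ys)
  have "circ_derives H w 1 {#C#} {#insert (Pos y) C, insert (Neg y) C#}"
    using circ_derives_inference[of w "Split C y" 1 H] proper_split_cut(1)[of C w y] Cons.prems by simp
  then have *: "circ_derives H w 1 {#C#} {#insert (Pos y) C#}"
    by (rule circ_derives_trans[where n=0]) (auto intro: circ_derives_subset)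
  have "circ_derives H w (length ys) {#insert (Pos y) C#} {#insert (Pos y) C \<union> Pos ` set ys#}"
    using Cons.prems by (intro Cons.IH) (auto simp: card_insert_if)
  from circ_derives_trans[OF * this, of "length (y # ys)"] show ?case
    by simp
qed

text \<open>Resolving \<open>C \<or> x\<^sub>1 \<or> \<dots> \<or> x\<^sub>r\<close> against \<open>C \<or> \<not>x\<^sub>r\<close>, \dots, \<open>C \<or> \<not>x\<^sub>1\<close> in turn, each of which is first
  weakened by splits. It serves pigeons with \<open>C\<close> empty and holes with \<open>C\<close> a negative literal.\<close>

lemma circ_derives_resolve:
  assumes "finite C" "card C + length xs \<le> w" "distinct xs"
    "\<And>x. x \<in> set xs \<Longrightarrow> Neg x \<notin> C \<and> Pos x \<notin> C"
  shows "circ_derives H w (length xs * length xs)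
    ({#C \<union> Pos ` set xs#} + mset (map (\<lambda>x. insert (Neg x) C) xs)) {#C#}"
  using assms(2-)
proof (induction xs rule: rev_induct)
  case Nil
  show ?case by (simp add: circ_derives_subset)
next
  case (snoc x xs)
  let ?n = "length xs" and ?C = "C \<union> Pos ` set xs"
  let ?R = "mset (map (\<lambda>x. insert (Neg x) C) xs)"
  have fin: "finite ?C" using assms(1) by simp
  have "card ?C \<le> card C + ?n"
    by (meson add_left_mono card_Un_le card_image_le card_length finite_set le_trans)
  then have card: "card ?C < w" using snoc.prems(1) by simp
  have "circ_derives H w ?n {#insert (Neg x) C#} {#insert (Neg x) C \<union> Pos ` set xs#}"
    using assms(1) snoc.prems by (intro circ_derives_weaken) (auto simp: card_insert_if)
  then have "circ_derives H w ?n {#insert (Neg x) C#} {#insert (Neg x) ?C#}" by simp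
  from circ_derives_frame[OF this, of "{#insert (Pos x) ?C#}"]
  have "circ_derives H w ?n {#insert (Pos x) ?C, insert (Neg x) C#}
    {#insert (Pos x) ?C, insert (Neg x) ?C#}"
    by (simp add: add_mset_commute)
  moreover have "circ_derives H w 1 {#insert (Pos x) ?C, insert (Neg x) ?C#} {#?C#}"
    using circ_derives_inference[of w "Cut ?C x" 1 H] proper_split_cut(2)[OF fin card, of x] snoc.prems
    by auto
  ultimately have "circ_derives H w (?n + 1) {#insert (Pos x) ?C, insert (Neg x) C#} {#?C#}"
    by (rule circ_derives_trans) simp
  from circ_derives_frame[OF this, of ?R]
  have "circ_derives H w (?n + 1) ({#insert (Pos x) ?C, insert (Neg x) C#} + ?R) ({#?C#} + ?R)" .
  moreover have "circ_derives H w (?n * ?n) ({#?C#} + ?R) {#C#}"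
    using snoc.prems by (intro snoc.IH) auto
  \<comment> \<open>The new variable costs n splits and one cut, and n^2 + n + 1 <= (n +
    1)^2.\<close>
  ultimately have "circ_derives H w (length (xs @ [x]) * length (xs @ [x]))
      ({#insert (Pos x) ?C, insert (Neg x) C#} + ?R) {#C#}"
    by (rule circ_derives_trans) simp
  then show ?case by (simp add: add_mset_commute)
qed

text \<open>Induction on \<open>xs\<close>: the positive clause is split on a new variable
  \<open>x\<close>. The positive half is the longer clause; the negative half is resolved against
  the hypotheses \<open>{Neg y, Neg x}\<close> down to \<open>{Neg x}\<close>.\<close>

lemma circ_derives_at_most_one:
  assumes "length xs \<le> w" "distinct xs"
    "\<And>x y. x \<in> set xs \<Longrightarrow> y \<in> set xs \<Longrightarrow> x \<noteq> y \<Longrightarrow> {Neg x, Neg y} \<in> H"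
  shows "circ_derives H w (length xs ^ 3) {#{}#} ({#Pos ` set xs#} + mset (map (\<lambda>x. {Neg x}) xs))"
  using assms
proof (induction xs rule: rev_induct)
  case Nil
  show ?case by (simp add: circ_derives_subset)
next
  case (snoc x xs)
  let ?n = "length xs" and ?C = "Pos ` set xs"
  let ?R = "mset (map (\<lambda>x. {Neg x}) xs)"
  let ?hyps = "mset (map (\<lambda>y. {Neg y, Neg x}) xs)"
  have "card ?C \<le> ?n"
    by (meson card_image_le card_length finite_set le_trans)
  then have card: "card ?C < w" using snoc.prems(1) by simp
  have "circ_derives H w 1 {#?C#} {#insert (Pos x) ?C, insert (Neg x) ?C#}"
    using circ_derives_inference[of w "Split ?C x" 1 H] proper_split_cut(1)[of ?C w x] card snoc.prems
    by auto
  moreover have "circ_derives H w 0 {#} ?hyps"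
    using snoc.prems by (intro circ_derives_hyp) auto
  ultimately have "circ_derives H w 1 ({#?C#} + {#}) ({#insert (Pos x) ?C, insert (Neg x) ?C#} + ?hyps)"
    by (rule circ_derives_add) simp
  then have 1: "circ_derives H w 1 {#?C#} ({#insert (Neg x) ?C#} + ?hyps + {#insert (Pos x) ?C#})"
    by (simp add: add_mset_commute)
  have "circ_derives H w (?n * ?n) ({#{Neg x} \<union> ?C#} + ?hyps) {#{Neg x}#}"
    using snoc.prems by (intro circ_derives_resolve) auto
  from circ_derives_frame[OF this, of "{#insert (Pos x) ?C#}"]
  have "circ_derives H w (?n * ?n) ({#insert (Neg x) ?C#} + ?hyps + {#insert (Pos x) ?C#})
     ({#{Neg x}#} + {#insert (Pos x) ?C#})"
    by simp
  from circ_derives_trans[OF 1 this order_refl]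
  have 2: "circ_derives H w (1 + ?n * ?n) {#?C#} {#{Neg x}, insert (Pos x) ?C#}"
    by (simp add: add_mset_commute)
  have "circ_derives H w (?n ^ 3) {#{}#} ({#?C#} + ?R)"
    using snoc.prems by (intro snoc.IH) auto
  \<comment> \<open>One split and n^2 resolution inferences are added, and n^3 + n^2 + 1 <= (n +
    1)^3.\<close>
  from circ_derives_trans[OF this circ_derives_frame[OF 2], of "length (xs @ [x]) ^ 3"]
  have "circ_derives H w (length (xs @ [x]) ^ 3) {#{}#} ({#{Neg x}, insert (Pos x) ?C#} + ?R)"
    by (simp add: power3_eq_cube algebra_simps)
  then show ?case by (simp add: add_mset_commute)
qed

section \<open>From totals to a circular proof graph\<close>

text \<open>For \<open>Q\<close> the premises or conclusions of an inference, the selected positions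
  are its neighbours in the graph. Neither \<open>js\<close> nor \<open>Q\<close> has repetitions,
  so the labels give back \<open>Q\<close> with its multiplicities.\<close>

lemma image_mset_nth_indices:
  assumes "distinct js" "set_mset Q \<subseteq> set js" "\<And>c. count Q c \<le> 1"
  shows "image_mset ((!) js) (mset_set {j. j < length js \<and> js ! j \<in># Q}) = Q"
proof -
  let ?S = "{j. j < length js \<and> js ! j \<in># Q}"
  have "inj_on ((!) js) ?S"
    using assms(1) by (auto simp: inj_on_def nth_eq_iff_index_eq)
  then have "image_mset ((!) js) (mset_set ?S) = mset_set ((!) js ` ?S)"
    by (rule image_mset_mset_set)
  also have "(!) js ` ?S = set_mset Q"
    using assms(2) by (auto simp: in_set_conv_nth subset_iff image_iff)
  also have "mset_set (set_mset Q) = Q"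
  proof (rule multiset_eqI)
    fix c
    show "count (mset_set (set_mset Q)) c = count Q c"
      using assms(3)[of c] count_greater_zero_iff[of Q c]
      by (auto simp: count_mset_set' simp del: count_greater_zero_iff)
  qed
  finally show ?thesis .
qed

text \<open>Under unit flow this cardinality is the flow into or out of the vertex of
  \<open>c\<close>, so balances become differences of multiset counts.\<close>

lemma card_indices_eq_count:
  assumes "\<And>i. i \<in> set L \<Longrightarrow> count (f i) c \<le> 1"
  shows "card {i. i < length L \<and> c \<in># f (L ! i)} = count (sum_list (map f L)) c"
proof -
  have "count (sum_list (map f L)) c = (\<Sum>i<length L. count (f (L ! i)) c)"
    by (induction L rule: rev_induct) (auto simp: nth_append)
  also have "\<dots> = (\<Sum>i<length L. if c \<in># f (L ! i) then 1 else 0)"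
  proof (rule sum.cong)
    fix i assume "i \<in> {..<length L}"
    then show "count (f (L ! i)) c = (if c \<in># f (L ! i) then 1 else 0)"
      using assms[of "L ! i"] count_greater_zero_iff[of "f (L ! i)" c]
      by (auto simp del: count_greater_zero_iff)
  qed simp
  also have "\<dots> = card {i. i < length L \<and> c \<in># f (L ! i)}"
    by (simp add: sum.If_cases Int_def)
  finally show ?thesis by simp
qed

text \<open>One formula-vertex per clause, one inference-vertex per list entry and unit flow; since such a proof
  cannot have a sink labelled by a hypothesis, the empty clause must not be one. The isolated
  formula-vertex \<open>D\<close> only serves to make the width exact.\<close>

lemma circular_refutation_of_circ_derives:
  fixes H :: "'x clause set" and D :: "'x clause"
  assumes der: "circ_derives H w n {#} {#{}#}" and "{} \<notin> H" and D: "finite D" "card D = w"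
  shows "\<exists>P :: (nat, nat, 'x) circular. circular_refutation P H \<and>
    proof_length P \<le> 4 * n + 1 \<and> proof_width P = w"
proof -
  obtain L K where L: "length L \<le> n" "\<forall>i\<in>set L. proper_inference w i" "set_mset K \<subseteq> H"
    and sub: "sum_list (map premise_clauses L) + {#{}#} \<subseteq># sum_list (map conclusion_clauses L) + {#} + K"
    using der unfolding circ_derives_def by blast
  have cnt: "count (sum_list (map premise_clauses L)) c + count {#{}#} c
    \<le> count (sum_list (map conclusion_clauses L)) c + count K c" for c
    using mset_subset_eq_count[OF sub, of c] by (auto split: if_splits)
  define cl where "cl i = premise_clauses i + conclusion_clauses i" for i :: "'x inference"
  define S where "S = insert D (\<Union>i\<in>set L. set_mset (cl i))"
  have size: "card (set_mset (cl i)) \<le> 3" for i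
  proof -
    have "card (set_mset (cl i)) \<le> size (cl i)"
      using size_mset_mono[OF mset_set_set_mset_msubset[of "cl i"]] by simp
    also have "\<dots> \<le> 3" by (cases i) (auto simp: cl_def)
    finally show ?thesis .
  qed
  have "card (\<Union>i\<in>set L. set_mset (cl i)) \<le> (\<Sum>i\<in>set L. card (set_mset (cl i)))"
    by (rule card_UN_le) simp
  also have "\<dots> \<le> card (set L) * 3"
    using sum_bounded_above[of "set L" "\<lambda>i. card (set_mset (cl i))" 3] size by simp
  also have "\<dots> \<le> length L * 3" by (simp add: card_length)
  \<comment> \<open>At most three clauses per inference, and one more for \<open>D\<close>; counting
    the inferences too gives the length \<open>4 * n + 1\<close>.\<close>
  finally have cardS: "card S \<le> 3 * n + 1"
    using L(1) unfolding S_def by (intro order.trans[OF card_insert_le_m1]) auto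
  have finS: "finite S" unfolding S_def by simp
  have clS: "finite c \<and> card c \<le> w" if "c \<in> S" for c
    using that D L(2) unfolding S_def cl_def proper_inference_def by auto
  obtain js where js: "set js = S" "distinct js"
    using finite_distinct_list[OF finS] by blast
  define P :: "(nat, nat, 'x) circular" where "P =
    \<lparr> formula_verts = {..<length js}, inference_verts = {..<length L},
      prem_arcs = {(j, i). j < length js \<and> i < length L \<and> js ! j \<in># premise_clauses (L ! i)},
      concl_arcs = {(i, j). j < length js \<and> i < length L \<and> js ! j \<in># conclusion_clauses (L ! i)},
      clause_at = (!) js, inference_at = (!) L \<rparr>"
  have cnt1: "count (premise_clauses i) c \<le> 1" "count (conclusion_clauses i) c \<le> 1"
    if "i \<in> set L" for i c
    using L(2) that unfolding proper_inference_def by auto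
  have "circular_preproof P"
    unfolding circular_preproof_def
  proof (intro conjI ballI)
    fix i assume "i \<in> inference_verts P"
    then have i: "i < length L" "L ! i \<in> set L" by (auto simp: P_def)
    then have "set_mset (premise_clauses (L ! i)) \<subseteq> set js"
      "set_mset (conclusion_clauses (L ! i)) \<subseteq> set js"
      unfolding js(1) S_def cl_def by auto
    then show "image_mset (clause_at P) (mset_set {j. (j, i) \<in> prem_arcs P})
          = premise_clauses (inference_at P i)"
      "image_mset (clause_at P) (mset_set {j. (i, j) \<in> concl_arcs P})
          = conclusion_clauses (inference_at P i)"
      using i cnt1[OF i(2)] image_mset_nth_indices[OF js(2)] by (simp_all add: P_def)
  next
    fix j assume "j \<in> formula_verts P"
    then show "finite (clause_at P j)"
      using js(1) clS by (auto simp: P_def)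
  qed (auto simp: P_def)
  have balance: "balance P (\<lambda>_. 1) j = real (count (sum_list (map conclusion_clauses L)) (js ! j))
     - real (count (sum_list (map premise_clauses L)) (js ! j))" if "j < length js" for j
    using that card_indices_eq_count[of L conclusion_clauses "js ! j"]
      card_indices_eq_count[of L premise_clauses "js ! j"] cnt1
    by (simp add: balance_def P_def)
  have notH: "count K c = 0" if "c \<notin> H" for c
    using L(3) that by (auto simp: not_in_iff[symmetric])
  \<comment> \<open>\<open>K\<close> has no copy of the empty clause, so the required one must be a
    conclusion.\<close>
  have "count (sum_list (map conclusion_clauses L)) {} > 0"
    using cnt[of "{}"] notH[OF \<open>{} \<notin> H\<close>] by (simp del: count_greater_zero_iff)
  then have "{} \<in># sum_list (map conclusion_clauses L)"
    by (simp only: count_greater_zero_iff)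
  then have "{} \<in> S"
    by (auto simp: S_def cl_def set_mset_sum_list)
  then obtain j0 where j0: "j0 < length js" "js ! j0 = {}"
    using js(1) by (metis in_set_conv_nth)
  have "circular_proof P H {}"
    unfolding circular_proof_def
  proof (intro conjI exI[of _ "\<lambda>_. 1"] ballI impI bexI[of _ j0])
    show "flow_assignment P (\<lambda>_. 1)" by (simp add: flow_assignment_def)
    show "balance P (\<lambda>_. 1) j0 > 0"
      using cnt[of "{}"] notH[OF \<open>{} \<notin> H\<close>] j0 by (simp add: balance)
    show "clause_at P j0 = {}" "j0 \<in> formula_verts P" using j0 by (auto simp: P_def)
    fix j assume j: "j \<in> formula_verts P" "balance P (\<lambda>_. 1) j < 0"
    then have "j < length js" by (simp add: P_def)
    \<comment> \<open>Where premises outnumber conclusions, only \<open>K\<close> can cover the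
      deficit.\<close>
    then have "count K (js ! j) \<noteq> 0"
      using j(2) cnt[of "js ! j"] by (auto simp: balance)
    then show "clause_at P j \<in> H"
      using L(3) by (auto simp: P_def)
  qed fact
  moreover have "proof_length P \<le> 4 * n + 1"
    using cardS L(1) distinct_card[OF js(2)] js(1) by (simp add: proof_length_def P_def)
  moreover have "proof_width P = w"
  proof -
    have "(\<lambda>j. card (clause_at P j)) ` formula_verts P = card ` S"
      unfolding js(1)[symmetric] by (force simp: P_def set_conv_nth)
    moreover have "Max (card ` S) = w"
      using finS clS D by (intro Max_eqI) (auto simp: S_def)
    ultimately show ?thesis by (simp add: proof_width_def)
  qed
  ultimately show ?thesis unfolding circular_refutation_def by blast
qed

text \<open>Two vertices carry the empty clause: vertex 0 is the source; splitting it on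
  \<open>X\<close> and cutting again makes vertex 3 the sink. The isolated vertex 4 carries
  \<open>D\<close> to fix the width.\<close>

lemma circular_refutation_of_empty:
  fixes H :: "'x clause set" and D :: "'x clause"
  assumes "{} \<in> H" and D: "finite D"
  shows "\<exists>P :: (nat, nat, 'x) circular. circular_refutation P H \<and>
    proof_length P \<le> 7 \<and> proof_width P = max (card D) 1"
proof -
  fix X :: 'x
  define P :: "(nat, nat, 'x) circular" where "P =
    \<lparr> formula_verts = {0,1,2,3,4}, inference_verts = {0,1},
      prem_arcs = {(0,0), (1,1), (2,1)}, concl_arcs = {(0,1), (0,2), (1,3)},
      clause_at = (\<lambda>j. [{}, {Pos X}, {Neg X}, {}, D] ! j),
      inference_at = (\<lambda>i. [Split {} X, Cut {} X] ! i) \<rparr>"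
  have arcs: "{j. (j, 0) \<in> prem_arcs P} = {0}" "{j. (j, Suc 0) \<in> prem_arcs P} = {1,2}"
    "{j. (0, j) \<in> concl_arcs P} = {1,2}" "{j. (Suc 0, j) \<in> concl_arcs P} = {3}"
    by (auto simp: P_def)
  have arcs': "{i. (0, i) \<in> prem_arcs P} = {0}" "{i. (Suc 0, i) \<in> prem_arcs P} = {1}"
    "{i. (2, i) \<in> prem_arcs P} = {1}" "{i. (3, i) \<in> prem_arcs P} = {}"
    "{i. (4, i) \<in> prem_arcs P} = {}" "{i. (i, 0) \<in> concl_arcs P} = {}"
    "{i. (i, Suc 0) \<in> concl_arcs P} = {0}" "{i. (i, 2) \<in> concl_arcs P} = {0}"
    "{i. (i, 3) \<in> concl_arcs P} = {1}" "{i. (i, 4) \<in> concl_arcs P} = {}"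
    by (auto simp: P_def)
  have sel: "formula_verts P = {0,1,2,3,4}" "inference_verts P = {0,1}"
    "clause_at P = (\<lambda>j. [{}, {Pos X}, {Neg X}, {}, D] ! j)"
    "inference_at P = (\<lambda>i. [Split {} X, Cut {} X] ! i)"
    by (simp_all add: P_def)
  have "circular_preproof P"
    unfolding circular_preproof_def using D
    by (simp add: arcs sel) (auto simp: P_def)
  moreover have "\<forall>j\<in>formula_verts P. balance P (\<lambda>_. 1) j < 0 \<longrightarrow> clause_at P j \<in> H"
    using assms(1) by (simp add: sel balance_def arcs')
  moreover have "3 \<in> formula_verts P \<and> balance P (\<lambda>_. 1) 3 > 0 \<and> clause_at P 3 = {}"
    by (simp add: sel balance_def arcs')
  ultimately have "circular_refutation P H"
    unfolding circular_refutation_def circular_proof_def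
    by (auto simp: flow_assignment_def intro!: exI[of _ "\<lambda>_. 1"])
  moreover have "proof_length P \<le> 7"
    by (simp add: proof_length_def sel)
  moreover have "proof_width P = max (card D) 1"
    by (simp add: proof_width_def sel max_def)
  ultimately show ?thesis by blast
qed

section \<open>Pigeons, holes and the final bounds\<close>

lemma graph_php_circ_derives_empty:
  assumes G: "bipartite_graph U V E" and "card U > card V"
    and deg: "\<And>w. w \<in> U \<union> V \<Longrightarrow> card (neighbours E w) \<le> d"
  shows "circ_derives (graph_php U E) d (card V * d ^ 3 + card U * d ^ 2) {#} {#{}#}"
proof -
  let ?H = "graph_php U E"
  let ?negs = "\<lambda>S. image_mset (\<lambda>e. {Neg e}) (mset_set S)"
  have fin: "finite U" "finite V" "finite E" and E: "E \<subseteq> U \<times> V" and disj: "U \<inter> V = {}"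
    using G unfolding bipartite_graph_def by (auto intro: finite_subset[of E "U \<times> V"])
  have nU: "neighbours E u = {v. (u, v) \<in> E}" if "u \<in> U" for u
    using that E disj by (auto simp: neighbours_def)
  have nV: "neighbours E v = {u. (u, v) \<in> E}" if "v \<in> V" for v
    using that E disj by (auto simp: neighbours_def)
  \<comment> \<open>Used with both \<open>fst\<close> and \<open>snd\<close>: what the holes produce
    in total is exactly what the pigeons consume.\<close>
  have negs_sum: "?negs E = (\<Sum>s\<in>S. ?negs {e \<in> E. f e = s})"
    if "finite S" "f ` E \<subseteq> S" for S and f :: "'a \<times> 'a \<Rightarrow> 'a"
  proof -
    have "?negs E = (\<Sum>e\<in>E. {#{Neg e}#})" by (simp add: sum_unfold_sum_mset)
    also have "\<dots> = (\<Sum>s\<in>S. \<Sum>e | e \<in> E \<and> f e = s. {#{Neg e}#})"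
      using sum.group[OF fin(3) that, of "\<lambda>e. {#{Neg e}#}"] by simp
    finally show ?thesis by (simp add: sum_unfold_sum_mset)
  qed
  have pigeon: "circ_derives ?H d (d ^ 2) (?negs {e \<in> E. fst e = u}) {#{}#}" if u: "u \<in> U" for u
  proof -
    let ?Eu = "{e \<in> E. fst e = u}"
    have Eu: "?Eu = Pair u ` neighbours E u" using nU[OF u] by force
    obtain xs where xs: "set xs = ?Eu" "distinct xs"
      using finite_distinct_list[of ?Eu] fin by auto
    have len: "length xs \<le> d"
      using distinct_card[OF xs(2)] xs(1) Eu deg[of u] u by (simp add: card_image inj_on_def)
    have "Pos ` set xs = {Pos (u, v) | v. v \<in> neighbours E u}"
      unfolding xs(1) Eu by auto
    then have "Pos ` set xs \<in> ?H"
      using u unfolding graph_php_def by blast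
    then have hyp: "circ_derives ?H d 0 {#} {#Pos ` set xs#}"
      by (intro circ_derives_hyp) simp
    have "mset (map (\<lambda>e. {Neg e}) xs) = ?negs ?Eu"
      unfolding xs(1)[symmetric] by (simp add: mset_set_set[OF xs(2)])
    then have res: "circ_derives ?H d (length xs * length xs) ({#Pos ` set xs#} + ?negs ?Eu) {#{}#}"
      using circ_derives_resolve[of "{}" xs d ?H] len xs(2) by simp
    have "length xs * length xs \<le> d ^ 2"
      using len by (simp add: power2_eq_square mult_mono)
    then show ?thesis
      using circ_derives_trans[OF circ_derives_frame[OF hyp, of "?negs ?Eu"] res, of "d ^ 2"] by simp
  qed
  have hole: "circ_derives ?H d (d ^ 3) {#{}#} (?negs {e \<in> E. snd e = v})" if v: "v \<in> V" for v
  proof -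
    let ?Ev = "{e \<in> E. snd e = v}"
    have Ev: "?Ev = (\<lambda>u. (u, v)) ` neighbours E v" using nV[OF v] by force
    obtain xs where xs: "set xs = ?Ev" "distinct xs"
      using finite_distinct_list[of ?Ev] fin by auto
    have len: "length xs \<le> d"
      using distinct_card[OF xs(2)] xs(1) Ev deg[of v] v by (simp add: card_image inj_on_def)
    have hyps: "{Neg x, Neg y} \<in> ?H" if "x \<in> set xs" "y \<in> set xs" "x \<noteq> y" for x y
    proof -
      obtain u1 u2 where "x = (u1, v)" "y = (u2, v)" "(u1, v) \<in> E" "(u2, v) \<in> E" "u1 \<noteq> u2"
        using \<open>x \<in> set xs\<close> \<open>y \<in> set xs\<close> \<open>x \<noteq> y\<close> unfolding xs(1) by (cases x; cases y) auto
      moreover from this have "u1 \<in> U" "u2 \<in> U" using E by auto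
      ultimately show ?thesis
        unfolding graph_php_def using nU by blast
    qed
    have "mset (map (\<lambda>e. {Neg e}) xs) = ?negs ?Ev"
      unfolding xs(1)[symmetric] by (simp add: mset_set_set[OF xs(2)])
    then have "circ_derives ?H d (length xs ^ 3) {#{}#} ({#Pos ` set xs#} + ?negs ?Ev)"
      using circ_derives_at_most_one[OF len xs(2) hyps] by simp
    \<comment> \<open>The clause of positive literals is left as surplus.\<close>
    then show ?thesis
      by (rule circ_derives_trans[where n=0]) (use len in \<open>auto intro: circ_derives_subset simp: power_mono\<close>)
  qed
  have "circ_derives ?H d (card V * d ^ 3) (\<Sum>v\<in>V. {#{}#}) (?negs E)"
    by (subst negs_sum[of V snd]) (use E fin in \<open>auto intro: circ_derives_sum hole\<close>)
  moreover have "circ_derives ?H d (card U * d ^ 2) (?negs E) (\<Sum>u\<in>U. {#{}#})"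
    by (subst negs_sum[of U fst]) (use E fin in \<open>auto intro: circ_derives_sum pigeon\<close>)
  ultimately have "circ_derives ?H d (card V * d ^ 3 + card U * d ^ 2)
      (\<Sum>v\<in>V. {#{}#}) (\<Sum>u\<in>U. {#{}#})"
    by (rule circ_derives_trans) simp
  moreover have const: "(\<Sum>s\<in>S. {#c#}) = replicate_mset (card S) c" for S :: "'a set" and c :: "('a \<times> 'a) clause"
    by (induction S rule: infinite_finite_induct) auto
  ultimately have main: "circ_derives ?H d (card V * d ^ 3 + card U * d ^ 2)
      (replicate_mset (card V) {}) (replicate_mset (card U) {})"
    by (simp only: const)
  \<comment> \<open>Of the copies produced, \<open>card V\<close> are fed back by cancellation and
    one is kept.\<close>
  have "{#{}#} + replicate_mset (card V) {} \<subseteq># replicate_mset (card U) ({} :: ('a \<times> 'a) clause)"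
    using \<open>card U > card V\<close> by (auto simp: subseteq_mset_def)
  from circ_derives_trans[OF main circ_derives_subset[OF this, of _ _ 0] order_refl]
  have "circ_derives ?H d (card V * d ^ 3 + card U * d ^ 2)
      ({#} + replicate_mset (card V) {}) ({#{}#} + replicate_mset (card V) {})"
    by simp
  then show ?thesis by (rule circ_derives_cancel)
qed

theorem theorem5:
  "\<exists>p :: nat poly. \<forall>(U :: 'a set) (V :: 'a set) (E :: ('a \<times> 'a) set) (d :: nat).
     bipartite_graph U V E \<longrightarrow> max_degree U V E = d \<longrightarrow> card U > card V \<longrightarrow>
     (\<exists>P :: (nat, nat, 'a \<times> 'a) circular.
        circular_refutation P (graph_php U E) \<and>
        proof_length P \<le> poly p (card U + card V) \<and>
        proof_width P = max d 1)"
\<comment> \<open>With N the number of vertices of the graph, the general case has length at most 4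
  N^4 + 1; the 7 also covers the case where the empty clause is a hypothesis.\<close>
proof (intro exI[of _ "monom 4 4 + [:7:]"] allI impI)
  fix U V :: "'a set" and E :: "('a \<times> 'a) set" and d :: nat
  assume G: "bipartite_graph U V E" and d: "max_degree U V E = d" and UV: "card U > card V"
  let ?N = "card U + card V"
  have fin: "finite U" "finite V" and E: "E \<subseteq> U \<times> V" and disj: "U \<inter> V = {}"
    using G by (auto simp: bipartite_graph_def)
  have U: "U \<noteq> {}" using UV by auto
  have sub: "neighbours E w \<subseteq> U \<union> V" for w
    using E by (auto simp: neighbours_def)
  have finN: "finite (neighbours E w)" for w
    using sub fin by (meson finite_UnI finite_subset)
  have deg: "card (neighbours E w) \<le> d" if "w \<in> U \<union> V" for w
    using that fin unfolding d[symmetric] max_degree_def by (intro Max_ge) auto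
  have "d \<in> (\<lambda>w. card (neighbours E w)) ` (U \<union> V)"
    unfolding d[symmetric] max_degree_def using fin U by (intro Max_in) auto
  then obtain w where w: "card (neighbours E w) = d" by auto
  \<comment> \<open>Only the size \<open>d\<close> of this clause matters: if \<open>w\<close> lies
    in \<open>V\<close>, its variables are not even edges.\<close>
  define D where "D = Pos ` Pair w ` neighbours E w"
  have D: "finite D" "card D = d"
    unfolding D_def using finN w by (auto simp: card_image inj_on_def)
  have dN: "d \<le> ?N"
    using card_mono[OF _ sub[of w]] fin w disj by (simp add: card_Un_disjoint)
  show "\<exists>P :: (nat, nat, 'a \<times> 'a) circular. circular_refutation P (graph_php U E) \<and>
        proof_length P \<le> poly (monom 4 4 + [:7:]) ?N \<and> proof_width P = max d 1"
  proof (cases "{} \<in> graph_php U E")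
    case True
    then obtain P :: "(nat, nat, 'a \<times> 'a) circular" where
      P: "circular_refutation P (graph_php U E)" "proof_length P \<le> 7" "proof_width P = max d 1"
      using circular_refutation_of_empty[OF True D(1)] D(2) by auto
    have "proof_length P \<le> poly (monom 4 4 + [:7:]) ?N"
      using P(2) by (simp add: poly_monom)
    with P show ?thesis by blast
  next
    case False
    obtain u where u: "u \<in> U" using U by blast
    \<comment> \<open>An isolated pigeon would contribute the empty clause. Hence \<open>d\<close>
      is positive and \<open>max d 1\<close> is \<open>d\<close>.\<close>
    with False have "neighbours E u \<noteq> {}"
      unfolding graph_php_def by blast
    then have "d \<ge> 1"
      using deg[of u] u finN[of u] card_gt_0_iff[of "neighbours E u"] by simp
    obtain P :: "(nat, nat, 'a \<times> 'a) circular" where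
      P: "circular_refutation P (graph_php U E)"
        "proof_length P \<le> 4 * (card V * d ^ 3 + card U * d ^ 2) + 1" "proof_width P = d"
      using circular_refutation_of_circ_derives[OF graph_php_circ_derives_empty[OF G UV deg] False D]
      by auto
    have "card V * d ^ 3 + card U * d ^ 2 \<le> card V * d ^ 3 + card U * d ^ 3"
      using \<open>d \<ge> 1\<close> by (simp add: power_increasing)
    also have "\<dots> = ?N * d ^ 3" by (simp add: algebra_simps)
    also have "\<dots> \<le> ?N * ?N ^ 3" by (intro mult_left_mono power_mono dN) auto
    also have "\<dots> = ?N ^ 4" by (simp add: eval_nat_numeral)
    finally have "proof_length P \<le> poly (monom 4 4 + [:7:]) ?N"
      using P(2) by (simp add: poly_monom)
    with P \<open>d \<ge> 1\<close> show ?thesis by auto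
  qed
qed

end
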